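(* Let $n \geqslant 2$. Any knotted subgroup of $SU(n)$ is ambient automorphic to a knotted subgroup of $SU(n)$ of the form $\gamma(t)=\operatorname{diag}\left(e^{it\beta_1},e^{it\beta_2},\ldots,e^{it\beta_n}\right)$, where $\beta_\ell\in\mathbb{R}$ for all $\ell$.
   Context: A knotted subgroup of a Lie group $G$ is a continuous injective group homomorphism $\gamma:S^1\to G$ with continuous inverse (defined on its image); its image is also called a knotted subgroup. Here $S^1\cong\mathbb{R}/2\pi\mathbb{Z}$, and the argument of $\gamma$ is written as $t$ (mod $2\pi$). Given knotted subgroups $\phi_1,\phi_2:S^1\to G$, an ambient automorphism from $\phi_1$ to $\phi_2$ is a continuous map $F:G\times[0,1]\to G$ such that, writing $F_t(A):=F(A,t)$: $F_0$ is the identity map on $G$; $F_t$ is both a homeomorphism and a group automorphism of $G$ for all $t\in[0,1]$; and $F_1\circ\phi_1=\phi_2$. In this case $\phi_1$ is said to be ambient automorphic to $\phi_2$. *)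

theory Defs
  imports "HOL-Analysis.Analysis" "HOL-Algebra.Group"
begin

text \<open>
  The circle is the group of unit complex numbers, with the parameter \<open>t\<close> (mod \<open>2 \<pi>\<close>)
  standing for the point \<open>cis t\<close>.
\<close>

definition circle_group :: "complex monoid" where
  "circle_group = \<lparr>carrier = sphere 0 1, mult = (*), one = 1\<rparr>"

text \<open>
  The following notions use only the group structure and the topology of the ambient Lie group,
  so it is given as a monoid record whose carrier has the subspace topology of its type.
  Maps are total functions and matter only on the carriers.
\<close>

definition knotted_subgroup :: "('a::topological_space) monoid \<Rightarrow> (complex \<Rightarrow> 'a) \<Rightarrow> bool" where
  "knotted_subgroup G \<gamma> \<longleftrightarrow>
     \<gamma> \<in> hom circle_group G \<and>
     continuous_on (carrier circle_group) \<gamma> \<and>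
     inj_on \<gamma> (carrier circle_group) \<and>
     continuous_on (\<gamma> ` carrier circle_group) (inv_into (carrier circle_group) \<gamma>)"

definition ambient_automorphism ::
  "('a::topological_space) monoid \<Rightarrow> (complex \<Rightarrow> 'a) \<Rightarrow> (complex \<Rightarrow> 'a) \<Rightarrow> ('a \<times> real \<Rightarrow> 'a) \<Rightarrow> bool" where
  "ambient_automorphism G \<phi>1 \<phi>2 F \<longleftrightarrow>
     continuous_on (carrier G \<times> {0..1}) F \<and>
     F ` (carrier G \<times> {0..1}) \<subseteq> carrier G \<and>
     (\<forall>A\<in>carrier G. F (A, 0) = A) \<and>
     (\<forall>t\<in>{0..1}. (\<exists>g. homeomorphism (carrier G) (carrier G) (\<lambda>A. F (A, t)) g) \<and>
                  (\<lambda>A. F (A, t)) \<in> iso G G) \<and>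
     (\<forall>z\<in>carrier circle_group. F (\<phi>1 z, 1) = \<phi>2 z)"

definition ambient_automorphic ::
  "('a::topological_space) monoid \<Rightarrow> (complex \<Rightarrow> 'a) \<Rightarrow> (complex \<Rightarrow> 'a) \<Rightarrow> bool" where
  "ambient_automorphic G \<phi>1 \<phi>2 \<longleftrightarrow> (\<exists>F. ambient_automorphism G \<phi>1 \<phi>2 F)"

definition conj_transpose :: "complex^'n^'m \<Rightarrow> complex^'m^'n" where
  "conj_transpose A = (\<chi> i j. cnj (A $ j $ i))"

definition unitary_matrix :: "complex^'n^'n \<Rightarrow> bool" where
  "unitary_matrix A \<longleftrightarrow> conj_transpose A ** A = mat 1 \<and> A ** conj_transpose A = mat 1"

definition SU :: "(complex^'n^'n) monoid" where
  "SU = \<lparr>carrier = {A. unitary_matrix A \<and> det A = 1}, mult = (**), one = mat 1\<rparr>"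

definition diag_matrix :: "('n \<Rightarrow> complex) \<Rightarrow> complex^'n^'n" where
  "diag_matrix d = (\<chi> i j. if i = j then d i else 0)"

lemma group_circle_group: "group circle_group"
proof (rule groupI)
  fix x assume "x \<in> carrier circle_group"
  then have "norm x = 1"
    by (simp add: circle_group_def)
  then have "inverse x * x = 1"
    by (intro left_inverse) auto
  with \<open>norm x = 1\<close> show "\<exists>y\<in>carrier circle_group. y \<otimes>\<^bsub>circle_group\<^esub> x = \<one>\<^bsub>circle_group\<^esub>"
    by (intro bexI[of _ "inverse x"]) (auto simp: circle_group_def norm_inverse)
qed (auto simp: circle_group_def norm_mult)

lemma conj_transpose_mult:
  "conj_transpose (A ** B) = conj_transpose B ** conj_transpose A"
  by (simp add: conj_transpose_def matrix_matrix_mult_def vec_eq_iff mult.commute)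

lemma conj_transpose_mat_1: "conj_transpose (mat 1) = mat 1"
  by (auto simp: conj_transpose_def mat_def vec_eq_iff)

lemma conj_transpose_conj_transpose: "conj_transpose (conj_transpose A) = A"
  by (simp add: conj_transpose_def vec_eq_iff)

lemma unitary_matrix_mult:
  assumes "unitary_matrix A" "unitary_matrix B"
  shows "unitary_matrix (A ** B)"
proof -
  have "conj_transpose B ** conj_transpose A ** (A ** B)
      = conj_transpose B ** (conj_transpose A ** A) ** B"
    by (simp add: matrix_mul_assoc)
  moreover have "A ** B ** (conj_transpose B ** conj_transpose A)
      = A ** (B ** conj_transpose B) ** conj_transpose A"
    by (simp add: matrix_mul_assoc)
  ultimately show ?thesis
    using assms by (simp add: unitary_matrix_def conj_transpose_mult)
qed

lemma group_SU: "group (SU :: (complex^'n^'n) monoid)"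
proof (rule groupI)
  fix A :: "complex^'n^'n" assume "A \<in> carrier SU"
  then have A: "unitary_matrix A" "det A = 1"
    by (simp_all add: SU_def)
  have "det (conj_transpose A) * det A = det (conj_transpose A ** A)"
    by (simp add: det_mul)
  also have "\<dots> = 1"
    using A by (simp add: unitary_matrix_def)
  finally have "det (conj_transpose A) = 1"
    using A by simp
  then show "\<exists>B\<in>carrier SU. B \<otimes>\<^bsub>SU\<^esub> A = \<one>\<^bsub>SU\<^esub>"
    using A by (intro bexI[of _ "conj_transpose A"])
      (simp_all add: SU_def unitary_matrix_def conj_transpose_conj_transpose)
next
  show "\<one>\<^bsub>SU\<^esub> \<in> carrier SU"
    by (simp add: SU_def unitary_matrix_def conj_transpose_mat_1)
qed (simp_all add: SU_def unitary_matrix_mult det_mul matrix_mul_assoc)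

end

theory Submission
  imports Defs "HOL-Computational_Algebra.Fundamental_Theorem_Algebra"
begin

text \<open>
  Conjugation by a unitary matrix \<open>P\<close> is an automorphism of \<open>SU n\<close>, even if \<open>det P \<noteq> 1\<close>, and the
  unitary group is path connected. So, if \<open>p\<close> is a path of unitary matrices from the identity to
  \<open>P\<close>, then \<open>F (A, t) = (p t)\<^sup>* A (p t)\<close> is an ambient automorphism from a knotted subgroup \<open>\<phi>\<close> to
  its conjugate \<open>P\<^sup>* \<phi> P\<close> (lemma \<open>ambient_automorphic_conj_by\<close>), and this conjugate is again
  a knotted subgroup (lemma \<open>knotted_subgroup_conj_by\<close>). It remains to choose \<open>P\<close>.

  The circle is abelian, so the matrices \<open>\<phi> z\<close> form a commuting family of unitary matrices, and
  such a family has an orthonormal basis of common eigenvectors. The matrix \<open>P\<close> with these vectors as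
  columns makes all \<open>P\<^sup>* (\<phi> z) P\<close> diagonal
  (lemma \<open>commuting_unitary_simultaneously_diagonalizable\<close>). Each diagonal entry, as a function of
  \<open>t\<close> with \<open>z = cis t\<close>, is a continuous homomorphism from the reals to the unit circle, and these
  are exactly the functions \<open>exp (\<i> t \<beta>)\<close> (lemma \<open>continuous_unitary_character_of_reals\<close>).

  The diagonalization is used a second time, for the single matrix \<open>P\<close>: it writes \<open>P\<close> as
  \<open>Q D Q\<^sup>*\<close> with \<open>D\<close> diagonal with entries \<open>cis (\<theta> i)\<close>, and scaling the angles \<open>\<theta> i\<close> by
  \<open>t\<close> gives the path from the identity to \<open>P\<close> (lemma \<open>unitary_path_from_identity\<close>).
\<close>

section \<open>Common eigenvectors of commuting matrices\<close>

text \<open>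
  The vector \<open>p(A) v\<close>. Acting on vectors, rather than forming the matrix \<open>p(A)\<close>, keeps the
  computation inside an invariant subspace.
\<close>

definition poly_act :: "complex^'n^'n \<Rightarrow> complex poly \<Rightarrow> complex^'n \<Rightarrow> complex^'n" where
  "poly_act A p v = (\<Sum>i\<le>degree p. coeff p i *s ((*v) A ^^ i) v)"

lemma poly_act_eq_sum:
  assumes "degree p \<le> N"
  shows "poly_act A p v = (\<Sum>i\<le>N. coeff p i *s ((*v) A ^^ i) v)"
  unfolding poly_act_def using assms
  by (intro sum.mono_neutral_left) (auto simp: coeff_eq_0)

lemma poly_act_linear_factor:
  "poly_act A ([:-c, 1:] * q) v = A *v poly_act A q v - c *s poly_act A q v"
proof -
  let ?w = "\<lambda>i. ((*v) A ^^ i) v"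
  let ?p = "pCons 0 q - smult c q"
  have p: "[:-c, 1:] * q = ?p"
    by (simp add: mult_pCons_left)
  have "degree ?p \<le> Suc (degree q)"
    by (intro degree_diff_le) (auto intro: order.trans[OF degree_pCons_le] order.trans[OF degree_smult_le])
  then have "poly_act A ?p v = (\<Sum>i\<le>Suc (degree q). coeff ?p i *s ?w i)"
    by (rule poly_act_eq_sum)
  also have "\<dots> = (\<Sum>i\<le>Suc (degree q). coeff (pCons 0 q) i *s ?w i)
                - (\<Sum>i\<le>Suc (degree q). (c * coeff q i) *s ?w i)"
    by (simp add: vec.scale_left_diff_distrib sum_subtractf del: sum.atMost_Suc)
  also have "(\<Sum>i\<le>Suc (degree q). coeff (pCons 0 q) i *s ?w i)
      = (\<Sum>i\<le>degree q. coeff q i *s (A *v ?w i))"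
    by (subst sum.atMost_Suc_shift) simp
  also have "\<dots> = A *v poly_act A q v"
    by (simp add: poly_act_def vec.linear_sum[OF matrix_vector_mul_linear_gen] vector_scalar_commute)
  also have "(\<Sum>i\<le>Suc (degree q). (c * coeff q i) *s ?w i) = c *s (\<Sum>i\<le>Suc (degree q). coeff q i *s ?w i)"
    by (simp only: vec.scale_sum_right vec.scale_scale)
  also have "(\<Sum>i\<le>Suc (degree q). coeff q i *s ?w i) = poly_act A q v"
    by (rule poly_act_eq_sum[symmetric]) simp
  finally show ?thesis
    unfolding p .
qed

lemma poly_act_in_subspace:
  assumes W: "vec.subspace W" and inv: "\<And>w. w \<in> W \<Longrightarrow> A *v w \<in> W" and v: "v \<in> W"
  shows "poly_act A p v \<in> W"
proof -
  have "((*v) A ^^ i) v \<in> W" for i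
    by (induction i) (auto simp: v inv)
  then show ?thesis
    unfolding poly_act_def by (intro vec.subspace_sum[OF W] vec.subspace_scale[OF W])
qed

text \<open>
  The iterates \<open>v, A v, A\<^sup>2 v, \<dots>\<close> form an infinite sequence in a finite-dimensional space. Either
  two of them coincide, or they are linearly dependent; in both cases the relation between them is
  a nonzero polynomial that annihilates \<open>v\<close>.
\<close>

lemma exists_annihilating_poly:
  "\<exists>p. p \<noteq> 0 \<and> poly_act A p v = 0"
proof (cases "inj (\<lambda>i. ((*v) A ^^ i) v)")
  case True
  let ?w = "\<lambda>i. ((*v) A ^^ i) v"
  have "\<not> finite (range ?w)"
    using True finite_imageD by blast
  then have "vec.dependent (range ?w)"
    using vec.independent_bound_general by blast
  then obtain T u x where T: "finite T" "T \<subseteq> range ?w" "(\<Sum>y\<in>T. u y *s y) = 0" "x \<in> T" "u x \<noteq> 0"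
    unfolding vec.dependent_explicit by blast
  obtain I where I: "T = ?w ` I"
    using T(2) by (auto simp: subset_image_iff)
  have injI: "inj_on ?w I"
    using True by (rule inj_on_subset) simp
  have fI: "finite I"
    using T(1) I finite_image_iff injI by blast
  define N where "N = Max I"
  let ?c = "\<lambda>i. if i \<in> I then u (?w i) else 0"
  define p where "p = (\<Sum>i\<le>N. monom (?c i) i)"
  have IN: "i \<le> N" if "i \<in> I" for i
    using that fI by (simp add: N_def)
  have coeff_p: "coeff p i = ?c i" for i
    using IN by (auto simp: p_def coeff_sum)
  have "degree p \<le> N"
    by (rule degree_le) (use IN coeff_p in force)
  then have "poly_act A p v = (\<Sum>i\<le>N. ?c i *s ?w i)"
    by (simp only: poly_act_eq_sum coeff_p)
  also have "\<dots> = (\<Sum>i\<in>I. u (?w i) *s ?w i)"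
    using IN by (intro sum.mono_neutral_cong_right) auto
  also have "\<dots> = 0"
    using T(3) injI by (simp add: I sum.reindex)
  finally have "poly_act A p v = 0" .
  moreover have "p \<noteq> 0"
  proof -
    obtain i where "i \<in> I" "x = ?w i"
      using T(4) I by blast
    then have "coeff p i \<noteq> 0"
      using T(5) coeff_p by simp
    then show ?thesis by auto
  qed
  ultimately show ?thesis by blast
next
  case False
  then obtain i j where ij: "i < j" "((*v) A ^^ i) v = ((*v) A ^^ j) v"
    unfolding inj_def by (metis linorder_neqE_nat)
  define p :: "complex poly" where "p = monom 1 j - monom 1 i"
  have coeff_p: "coeff p k = (if k = j then 1 else 0) - (if k = i then 1 else 0)" for k
    by (simp add: p_def)
  have "degree p \<le> j"
    by (rule degree_le) (use ij coeff_p in auto)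
  then have "poly_act A p v = (\<Sum>k\<le>j. coeff p k *s ((*v) A ^^ k) v)"
    by (rule poly_act_eq_sum)
  also have "\<dots> = (\<Sum>k\<in>{i, j}. coeff p k *s ((*v) A ^^ k) v)"
    using ij by (intro sum.mono_neutral_right) (auto simp: coeff_p)
  also have "\<dots> = 0"
    using ij by (simp add: coeff_p)
  finally have "poly_act A p v = 0" .
  moreover have "p \<noteq> 0"
    using ij coeff_p[of j] by force
  ultimately show ?thesis by blast
qed

text \<open>
  Take a nonzero polynomial \<open>p\<close> with \<open>p(A) v = 0\<close> and split off linear factors \<open>x - c\<close>. As long
  as the cofactor still annihilates \<open>v\<close>, its degree is smaller; otherwise the cofactor maps \<open>v\<close> to an
  eigenvector for \<open>c\<close>. The degree cannot reach 0, since a nonzero constant does not annihilate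
  \<open>v \<noteq> 0\<close>.
\<close>

lemma exists_eigenvector_in_invariant_subspace:
  fixes A :: "complex^'n^'n"
  assumes W: "vec.subspace W" and inv: "\<And>w. w \<in> W \<Longrightarrow> A *v w \<in> W"
    and v: "v \<in> W" "v \<noteq> 0"
  shows "\<exists>w\<in>W. w \<noteq> 0 \<and> (\<exists>c. A *v w = c *s w)"
proof -
  obtain p where "p \<noteq> 0" "poly_act A p v = 0"
    using exists_annihilating_poly by blast
  then show ?thesis
  proof (induction "degree p" arbitrary: p)
    case 0
    then obtain a where "p = [:a:]"
      by (metis degree_eq_zeroE)
    with 0 v show ?case
      by (simp add: poly_act_def)
  next
    case (Suc d)
    then have "\<not> constant (poly p)"
      by (simp add: constant_degree)
    then obtain c where "poly p c = 0"
      using fundamental_theorem_of_algebra by blast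
    then obtain q where q: "p = [:-c, 1:] * q"
      by (auto simp: poly_eq_0_iff_dvd)
    then have q0: "q \<noteq> 0"
      using Suc by auto
    then have "degree p = Suc (degree q)"
      unfolding q by (subst degree_mult_eq) auto
    with Suc.hyps have d: "d = degree q"
      by simp
    show ?case
    proof (cases "poly_act A q v = 0")
      case True
      then show ?thesis
        using Suc.hyps(1)[OF d q0] by blast
    next
      case False
      have "A *v poly_act A q v = c *s poly_act A q v"
        using Suc.prems(2) unfolding q poly_act_linear_factor by simp
      then show ?thesis
        using False poly_act_in_subspace[OF W inv v(1)] by blast
    qed
  qed
qed

text \<open>
  If a vector of \<open>W\<close> is not yet a common eigenvector, some \<open>A\<close> in the family is not scalar on \<open>W\<close>.
  An eigenspace of \<open>A\<close> in \<open>W\<close> is then a smaller nonzero subspace, and it is invariant under the family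
  because the other members commute with \<open>A\<close>. So induction on the dimension applies.
\<close>

lemma exists_common_eigenvector_in_invariant_subspace:
  fixes \<A> :: "(complex^'n^'n) set"
  assumes comm: "\<And>A B. A \<in> \<A> \<Longrightarrow> B \<in> \<A> \<Longrightarrow> A ** B = B ** A"
    and "vec.subspace W" and "\<And>A w. A \<in> \<A> \<Longrightarrow> w \<in> W \<Longrightarrow> A *v w \<in> W"
    and "v \<in> W" "v \<noteq> 0"
  shows "\<exists>w\<in>W. w \<noteq> 0 \<and> (\<forall>A\<in>\<A>. \<exists>c. A *v w = c *s w)"
  using assms(2-)
proof (induction "vec.dim W" arbitrary: W v rule: less_induct)
  case less
  show ?case
  proof (cases "\<forall>A\<in>\<A>. \<exists>c. A *v v = c *s v")
    case True
    then show ?thesis using less.prems by blast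
  next
    case False
    then obtain A where A: "A \<in> \<A>" "\<And>c. A *v v \<noteq> c *s v"
      by blast
    obtain u c where u: "u \<in> W" "u \<noteq> 0" "A *v u = c *s u"
      using exists_eigenvector_in_invariant_subspace[of W A v] less.prems A(1) by blast
    define E where "E = {w\<in>W. A *v w = c *s w}"
    have E: "vec.subspace E"
      using less.prems(1) unfolding E_def vec.subspace_def
      by (auto simp: matrix_vector_right_distrib vec.scale_right_distrib vector_scalar_commute
          vec.scale_left_commute)
    have "E \<subset> W"
      using A(2) less.prems(3) by (auto simp: E_def)
    then have "vec.dim E < vec.dim W"
      by (intro vec.dim_psubset) (simp add: vec.span_eq_iff[THEN iffD2] E less.prems(1))
    moreover have "B *v w \<in> E" if "B \<in> \<A>" "w \<in> E" for B w
    proof -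
      have "A *v (B *v w) = B *v (A *v w)"
        using comm[OF A(1) that(1)] by (simp add: matrix_vector_mul_assoc)
      then show ?thesis
        using that less.prems(2) by (auto simp: E_def vector_scalar_commute)
    qed
    moreover have "u \<in> E"
      using u by (simp add: E_def)
    ultimately have "\<exists>w\<in>E. w \<noteq> 0 \<and> (\<forall>A\<in>\<A>. \<exists>c. A *v w = c *s w)"
      using less.hyps[OF _ E] u(2) by blast
    then show ?thesis
      by (auto simp: E_def)
  qed
qed

section \<open>Simultaneous diagonalization of commuting unitary matrices\<close>

text \<open>
  The Hermitian inner product, linear in the first argument. The inner product \<open>(\<bullet>)\<close> of the type
  is its real part, which does not detect orthogonality over the complex numbers.
\<close>

definition herm :: "complex^'n \<Rightarrow> complex^'n \<Rightarrow> complex" where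
  "herm v w = (\<Sum>i\<in>UNIV. v $ i * cnj (w $ i))"

lemma herm_scale_left: "herm (c *s v) w = c * herm v w"
  by (simp add: herm_def sum_distrib_left mult.assoc)

lemma herm_scale_right: "herm v (c *s w) = cnj c * herm v w"
  by (simp add: herm_def sum_distrib_left mult_ac)

lemma herm_diff_left: "herm (u - v) w = herm u w - herm v w"
  by (simp add: herm_def sum_subtractf algebra_simps)

lemma herm_add_left: "herm (u + v) w = herm u w + herm v w"
  by (simp add: herm_def sum.distrib algebra_simps)

lemma herm_sum_left: "herm (\<Sum>x\<in>S. f x) w = (\<Sum>x\<in>S. herm (f x) w)"
  by (induction S rule: infinite_finite_induct) (simp_all add: herm_add_left, simp_all add: herm_def)

lemma herm_swap: "herm w v = cnj (herm v w)"
  by (simp add: herm_def mult.commute)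

lemma herm_self: "herm v v = of_real ((norm v)\<^sup>2)"
proof -
  have "herm v v = (\<Sum>i\<in>UNIV. of_real ((norm (v $ i))\<^sup>2))"
    by (simp only: herm_def complex_norm_square)
  then show ?thesis
    by (simp add: norm_vec_def L2_set_def sum_nonneg)
qed

lemma herm_matrix_left: "herm (A *v v) w = herm v (conj_transpose A *v w)"
proof -
  have "herm (A *v v) w = (\<Sum>i\<in>UNIV. \<Sum>j\<in>UNIV. A $ i $ j * v $ j * cnj (w $ i))"
    by (simp add: herm_def matrix_vector_mult_def sum_distrib_right)
  also have "\<dots> = (\<Sum>j\<in>UNIV. \<Sum>i\<in>UNIV. A $ i $ j * v $ j * cnj (w $ i))"
    by (rule sum.swap)
  also have "\<dots> = herm v (conj_transpose A *v w)"
    by (simp add: herm_def matrix_vector_mult_def conj_transpose_def sum_distrib_left mult_ac)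
  finally show ?thesis .
qed

lemma conj_transpose_mult_nth:
  "(conj_transpose P ** X) $ i $ j = herm (column j X) (column i P)"
  by (simp add: matrix_matrix_mult_def conj_transpose_def herm_def column_def mult.commute)

lemma column_mult: "column j (A ** P) = A *v column j P"
  by (simp add: column_def matrix_matrix_mult_def matrix_vector_mult_def vec_eq_iff)

definition orthonormal :: "(complex^'n) set \<Rightarrow> bool" where
  "orthonormal S \<longleftrightarrow> (\<forall>s\<in>S. \<forall>t\<in>S. herm s t = (if s = t then 1 else 0))"

lemma orthonormal_independent:
  assumes "orthonormal S"
  shows "vec.independent S"
  unfolding vec.independent_explicit_module
proof (intro allI impI)
  fix T u v
  assume T: "finite T" "T \<subseteq> S" "(\<Sum>x\<in>T. u x *s x) = 0" "v \<in> T"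
  have "0 = herm (\<Sum>x\<in>T. u x *s x) v"
    using T(3) by (simp add: herm_def)
  also have "\<dots> = (\<Sum>x\<in>T. u x * herm x v)"
    by (simp add: herm_sum_left herm_scale_left)
  also have "\<dots> = (\<Sum>x\<in>T. if x = v then u x else 0)"
    using assms T(2,4) by (intro sum.cong) (auto simp: orthonormal_def subset_iff)
  also have "\<dots> = u v"
    using T(1,4) by simp
  finally show "u v = 0" by simp
qed

lemma orthonormal_card_le:
  fixes S :: "(complex^'n) set"
  assumes "orthonormal S"
  shows "finite S \<and> card S \<le> CARD('n)"
  using vec.independent_bound_general[OF orthonormal_independent[OF assms]] dim_subset_UNIV_cart_gen[of S] by linarith

text \<open>
  If only 0 were orthogonal to \<open>S\<close>, every vector would equal its orthogonal projection to the span
  of \<open>S\<close>, so that \<open>S\<close> would span the whole space.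
\<close>

lemma orthonormal_complement_nonzero:
  fixes S :: "(complex^'n) set"
  assumes S: "orthonormal S" and small: "card S < CARD('n)"
  shows "\<exists>v. v \<noteq> 0 \<and> (\<forall>s\<in>S. herm v s = 0)"
proof (rule ccontr)
  assume contra: "\<not> ?thesis"
  have fin: "finite S"
    using orthonormal_card_le[OF S] by blast
  have "v \<in> vec.span S" for v
  proof -
    \<comment> \<open>The part of \<open>v\<close> orthogonal to \<open>S\<close>.\<close>
    let ?r = "v - (\<Sum>s\<in>S. herm v s *s s)"
    have "herm ?r t = 0" if "t \<in> S" for t
    proof -
      have "(\<Sum>s\<in>S. herm v s * herm s t) = (\<Sum>s\<in>S. if s = t then herm v s else 0)"
        using S that by (intro sum.cong) (auto simp: orthonormal_def)
      then show ?thesis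
        using fin that by (simp add: herm_diff_left herm_sum_left herm_scale_left)
    qed
    then have "?r = 0"
      using contra by blast
    then have v: "v = (\<Sum>s\<in>S. herm v s *s s)"
      by simp
    show ?thesis
      by (subst v) (intro vec.span_sum vec.span_scale vec.span_base)
  qed
  then have "vec.dim (UNIV :: (complex^'n) set) \<le> card S"
    by (intro vec.dim_le_card fin) auto
  then show False
    using small unfolding vec_dim_card by simp
qed

text \<open>
  The adjoint of a unitary matrix is its inverse, so it has the same eigenvectors. This is what makes
  the orthogonal complement of a set of eigenvectors invariant.
\<close>

lemma unitary_eigenvector_adjoint:
  assumes A: "unitary_matrix A" and v: "A *v v = c *s v"
  shows "\<exists>d. conj_transpose A *v v = d *s v"
proof (cases "v = 0")
  case False
  have inv: "v = c *s (conj_transpose A *v v)"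
  proof -
    have "v = (conj_transpose A ** A) *v v"
      using A by (simp add: unitary_matrix_def)
    then show ?thesis
      by (simp add: matrix_vector_mul_assoc[symmetric] v vector_scalar_commute)
  qed
  then have "c \<noteq> 0"
    using False by auto
  then have "conj_transpose A *v v = inverse c *s v"
    by (subst (2) inv) (simp add: vector_smult_assoc)
  then show ?thesis by blast
qed simp

text \<open>
  A largest orthonormal set of common eigenvectors is a basis: otherwise its orthogonal complement
  is a nonzero subspace invariant under the family and contains one more common eigenvector, which
  after normalization enlarges the set.
\<close>

lemma exists_orthonormal_common_eigenbasis:
  fixes \<A> :: "(complex^'n^'n) set"
  assumes unit: "\<And>A. A \<in> \<A> \<Longrightarrow> unitary_matrix A"
    and comm: "\<And>A B. A \<in> \<A> \<Longrightarrow> B \<in> \<A> \<Longrightarrow> A ** B = B ** A"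
  shows "\<exists>S. orthonormal S \<and> card S = CARD('n) \<and> (\<forall>s\<in>S. \<forall>A\<in>\<A>. \<exists>c. A *v s = c *s s)"
proof -
  let ?P = "\<lambda>S. orthonormal S \<and> (\<forall>s\<in>S. \<forall>A\<in>\<A>. \<exists>c. A *v s = c *s s)"
  have "?P {}"
    by (simp add: orthonormal_def)
  moreover have "\<forall>S. ?P S \<longrightarrow> card S < Suc CARD('n)"
    using orthonormal_card_le by (metis less_Suc_eq_le)
  ultimately have "\<exists>S. ?P S \<and> (\<forall>T. ?P T \<longrightarrow> card T \<le> card S)"
    by (rule ex_has_greatest_nat[of ?P "{}" card "Suc CARD('n)"])
  then obtain S where S: "?P S" and max: "\<And>T. ?P T \<Longrightarrow> card T \<le> card S"
    by (elim exE conjE) blast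
  have fin: "finite S" and le: "card S \<le> CARD('n)"
    using orthonormal_card_le S by blast+
  have "\<not> card S < CARD('n)"
  proof
    assume "card S < CARD('n)"
    define W where "W = {v. \<forall>s\<in>S. herm v s = 0}"
    obtain v where v: "v \<in> W" "v \<noteq> 0"
      using orthonormal_complement_nonzero[of S] S \<open>card S < _\<close> by (auto simp: W_def)
    have W: "vec.subspace W"
      unfolding W_def vec.subspace_def by (auto simp: herm_add_left herm_scale_left) (simp add: herm_def)
    have "A *v w \<in> W" if A: "A \<in> \<A>" and w: "w \<in> W" for A w
    proof -
      have "herm (A *v w) s = 0" if s: "s \<in> S" for s
      proof -
        obtain d where "conj_transpose A *v s = d *s s"
          using unitary_eigenvector_adjoint unit A S s by blast
        then show ?thesis
          using w s by (simp add: herm_matrix_left herm_scale_right W_def)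
      qed
      then show ?thesis by (simp add: W_def)
    qed
    then obtain w where w: "w \<in> W" "w \<noteq> 0" and eig: "\<forall>A\<in>\<A>. \<exists>c. A *v w = c *s w"
      using exists_common_eigenvector_in_invariant_subspace[OF comm W _ v] by blast
    define u where "u = complex_of_real (inverse (norm w)) *s w"
    have uu: "herm u u = 1"
    proof -
      have "herm u u = of_real (inverse (norm w)) * (of_real (inverse (norm w)) * of_real ((norm w)\<^sup>2))"
        by (simp only: u_def herm_scale_left herm_scale_right herm_self[of w] complex_cnj_complex_of_real)
      then show ?thesis
        using w(2) by (simp add: power2_eq_square field_simps)
    qed
    have us: "herm u s = 0" "herm s u = 0" if "s \<in> S" for s
      using that w(1) herm_swap[of s u] by (simp_all add: u_def herm_scale_left W_def)
    have "u \<notin> S"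
      using us uu by force
    have "orthonormal (insert u S)"
      using S us uu by (auto simp: orthonormal_def)
    moreover have "\<exists>c. A *v u = c *s u" if A: "A \<in> \<A>" for A
    proof -
      obtain c where "A *v w = c *s w" using eig A by blast
      then have "A *v u = c *s u"
        unfolding u_def vector_scalar_commute by (simp only: vec.scale_left_commute)
      then show ?thesis by blast
    qed
    ultimately have "card (insert u S) \<le> card S"
      using S by (intro max conjI ballI) auto
    then show False
      using \<open>u \<notin> S\<close> fin by simp
  qed
  then show ?thesis
    using S le by (intro exI[of _ S]) auto
qed

text \<open>
  The columns of \<open>P\<close> are the vectors of an orthonormal basis of common eigenvectors.
\<close>

lemma commuting_unitary_simultaneously_diagonalizable:
  fixes \<A> :: "(complex^'n^'n) set"
  assumes unit: "\<And>A. A \<in> \<A> \<Longrightarrow> unitary_matrix A"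
    and comm: "\<And>A B. A \<in> \<A> \<Longrightarrow> B \<in> \<A> \<Longrightarrow> A ** B = B ** A"
  shows "\<exists>P. unitary_matrix P \<and> (\<forall>A\<in>\<A>. \<exists>d. conj_transpose P ** A ** P = diag_matrix d)"
proof -
  obtain S :: "(complex^'n) set" where S: "orthonormal S" "card S = CARD('n)"
    and eig: "\<forall>s\<in>S. \<forall>A\<in>\<A>. \<exists>c. A *v s = c *s s"
    using exists_orthonormal_common_eigenbasis[of \<A>] unit comm by blast
  have "finite S"
    using orthonormal_card_le S(1) by blast
  then obtain f where f: "bij_betw f (UNIV :: 'n set) S"
    using finite_same_card_bij[of "UNIV :: 'n set" S] S(2) by auto
  then have fS: "f i \<in> S" for i
    by (auto simp: bij_betw_def)
  have f_ortho: "herm (f j) (f i) = (if i = j then 1 else 0)" for i j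
    using S(1) fS f by (auto simp: orthonormal_def bij_betw_def inj_eq)
  define P :: "complex^'n^'n" where "P = (\<chi> i j. f j $ i)"
  have col: "column j P = f j" for j
    by (simp add: P_def column_def)
  have "conj_transpose P ** P = mat 1"
    by (auto simp: vec_eq_iff conj_transpose_mult_nth col f_ortho mat_def)
  then have "unitary_matrix P"
    by (simp add: unitary_matrix_def matrix_left_right_inverse)
  moreover have "\<exists>d. conj_transpose P ** A ** P = diag_matrix d" if A: "A \<in> \<A>" for A
  proof -
    have "\<forall>i. \<exists>c. A *v f i = c *s f i"
      using eig fS A by blast
    then obtain d where d: "\<And>i. A *v f i = d i *s f i"
      by metis
    have "conj_transpose P ** (A ** P) = diag_matrix d"
      by (auto simp: vec_eq_iff conj_transpose_mult_nth column_mult col d herm_scale_left f_ortho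
          diag_matrix_def)
    then show ?thesis
      by (auto simp: matrix_mul_assoc)
  qed
  ultimately show ?thesis by blast
qed

section \<open>Continuous unitary characters of the real line\<close>

lemma has_vector_derivative_translate:
  assumes "(f has_vector_derivative d) (at (s + t))"
  shows "((\<lambda>s. f (s + t)) has_vector_derivative d) (at s)"
proof -
  have "((\<lambda>s. s + t) has_vector_derivative 1) (at s)"
    by (auto intro!: derivative_eq_intros simp flip: has_real_derivative_iff_has_vector_derivative)
  then show ?thesis
    using vector_diff_chain_at[of "\<lambda>s. s + t" 1 s f d] assms by (simp add: o_def)
qed

text \<open>
  An antiderivative \<open>F\<close> of \<open>f\<close> satisfies \<open>F (a + t) - F t = f t * (F a - F 0)\<close>, because
  integrating \<open>f (s + t) = f s * f t\<close> over \<open>s\<close> in \<open>[0, a]\<close> gives both sides. Choosing \<open>a\<close> with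
  \<open>F a \<noteq> F 0\<close> expresses \<open>f\<close> by the differentiable function \<open>F\<close>.
\<close>

lemma continuous_real_character_differentiable_at_0:
  fixes f :: "real \<Rightarrow> complex"
  assumes cont: "continuous_on UNIV f" and hom: "\<And>s t. f (s + t) = f s * f t" and f0: "f 0 = 1"
  shows "\<exists>k. (f has_vector_derivative k) (at 0)"
proof -
  \<comment> \<open>The interval is large enough to contain \<open>s + t\<close> in its interior for \<open>0 \<le> s < 1\<close> and \<open>\<bar>t\<bar> < 1\<close>.\<close>
  obtain F where "\<And>x. x \<in> {-2..2} \<Longrightarrow> (F has_vector_derivative f x) (at x within {-2..2})"
    using antiderivative_continuous[of "-2" 2 f] continuous_on_subset[OF cont] by blast
  then have F: "(F has_vector_derivative f x) (at x)" if "x \<in> {-2<..<2}" for x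
    using that by (metis at_within_Icc_at greaterThanLessThan_iff less_imp_le atLeastAtMost_iff)
  \<comment> \<open>If \<open>F\<close> were constant on \<open>(0, 1)\<close>, its derivative \<open>f\<close> would vanish at \<open>1/2\<close>, but a homomorphism
    into a multiplicative group has no zero.\<close>
  have "\<exists>a\<in>{0<..<1}. F a \<noteq> F 0"
  proof (rule ccontr)
    assume "\<not> ?thesis"
    then have const: "F a = F 0" if "a \<in> {0<..<1}" for a
      using that by blast
    have "(F has_vector_derivative 0) (at (1/2))"
      by (rule has_vector_derivative_transform_within_open[of "\<lambda>_. F 0" _ _ "{0<..<1}"])
        (auto intro: const[symmetric])
    then have "f (1/2) = 0"
      using F[of "1/2"] vector_derivative_unique_at by fastforce
    then show False
      using hom[of "1/2" "-1/2"] f0 by simp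
  qed
  then obtain a where a: "0 < a" "a < 1" "F a \<noteq> F 0"
    by auto
  have shift: "f t = (F (a + t) - F t) / (F a - F 0)" if t: "t \<in> {-1<..<1}" for t
  proof -
    \<comment> \<open>Both terms have the same derivative in \<open>s\<close>, by the homomorphism property.\<close>
    let ?h = "\<lambda>s. F (s + t) - f t * F s"
    have "(?h has_vector_derivative 0) (at s within {0..a})" if s: "s \<in> {0..a}" for s
    proof -
      have "((\<lambda>s. F (s + t)) has_vector_derivative f (s + t)) (at s)"
        using s t a by (intro has_vector_derivative_translate F) auto
      moreover have "(F has_vector_derivative f s) (at s)"
        using s a by (intro F) auto
      ultimately have "(?h has_vector_derivative (f (s + t) - f t * f s)) (at s)"
        by (intro has_vector_derivative_diff has_vector_derivative_mult_right)
      then show ?thesis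
        by (simp add: hom mult.commute has_vector_derivative_at_within)
    qed
    then have "?h 0 = ?h a"
      using has_derivative_zero_unique[of "{0..a}" ?h 0 a] a
      by (auto simp: has_vector_derivative_def)
    then show ?thesis
      using a by (simp add: field_simps)
  qed
  have "((\<lambda>t. F (a + t)) has_vector_derivative f a) (at 0)"
    using has_vector_derivative_translate[of F "f a" 0 a] F[of a] a by (simp add: add.commute)
  moreover have "(F has_vector_derivative f 0) (at 0)"
    by (intro F) auto
  ultimately have "((\<lambda>t. (F (a + t) - F t) / (F a - F 0)) has_vector_derivative (f a - f 0) / (F a - F 0)) (at 0)"
    by (intro has_vector_derivative_divide has_vector_derivative_diff)
  then have "(f has_vector_derivative (f a - f 0) / (F a - F 0)) (at 0)"
    by (rule has_vector_derivative_transform_within_open[of _ _ _ "{-1<..<1}"])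
      (auto simp: shift)
  then show ?thesis by blast
qed

text \<open>
  The homomorphism property carries the derivative \<open>k\<close> at 0 to every point as \<open>f' = k f\<close>, hence
  \<open>f t = exp (k t)\<close>, and \<open>k\<close> is purely imaginary because the values have norm 1.
\<close>

lemma continuous_unitary_character_of_reals:
  fixes f :: "real \<Rightarrow> complex"
  assumes cont: "continuous_on UNIV f" and hom: "\<And>s t. f (s + t) = f s * f t"
    and norm: "\<And>t. norm (f t) = 1"
  shows "\<exists>\<beta>::real. \<forall>t. f t = exp (\<i> * of_real t * of_real \<beta>)"
proof -
  have f0: "f 0 = 1"
    using hom[of 0 0] norm[of 0] by force
  obtain k where k: "(f has_vector_derivative k) (at 0)"
    using continuous_real_character_differentiable_at_0[OF cont hom f0] by blast
  have deriv: "(f has_vector_derivative f t * k) (at t)" for t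
  proof -
    have "((\<lambda>s. f (s - t)) has_vector_derivative k) (at t)"
      using has_vector_derivative_translate[of f k t "- t"] k by simp
    then have "((\<lambda>s. f t * f (s - t)) has_vector_derivative f t * k) (at t)"
      by (rule has_vector_derivative_mult_right)
    then show ?thesis
      by (simp flip: hom)
  qed
  have exp_deriv: "((\<lambda>t. exp (of_real t * - k)) has_vector_derivative exp (of_real t * - k) * - k) (at t)" for t :: real
    by (rule has_vector_derivative_real_field) (auto intro!: derivative_eq_intros)
  have "((\<lambda>t. f t * exp (of_real t * - k)) has_vector_derivative 0) (at t)" for t
    using has_vector_derivative_mult[OF deriv[of t] exp_deriv[of t]] by (simp add: algebra_simps)
  then have "f t * exp (of_real t * - k) = f 0 * exp (of_real 0 * - k)" for t
    using has_derivative_zero_unique[of UNIV "\<lambda>t. f t * exp (of_real t * - k)" t 0]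
    by (auto simp: has_vector_derivative_def)
  then have f_exp: "f t = exp (of_real t * k)" for t
    by (simp add: f0 exp_minus field_simps)
  have "Re k = 0"
    using norm[of 1] by (simp add: f_exp)
  then have "k = \<i> * of_real (Im k)"
    by (simp add: complex_eq_iff)
  then have "f t = exp (\<i> * of_real t * of_real (Im k))" for t
    unfolding f_exp by (metis mult.assoc mult.commute)
  then show ?thesis by blast
qed

section \<open>Diagonal matrices and conjugation by unitary matrices\<close>

lemma continuous_on_matrix_mult:
  fixes f :: "'a::topological_space \<Rightarrow> complex^'n^'m" and g :: "'a \<Rightarrow> complex^'k^'n"
  assumes "continuous_on S f" "continuous_on S g"
  shows "continuous_on S (\<lambda>x. f x ** g x)"
  unfolding matrix_matrix_mult_def using assms by (intro continuous_intros)

lemma continuous_on_conj_transpose: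
  assumes "continuous_on S f"
  shows "continuous_on S (\<lambda>x. conj_transpose (f x))"
  unfolding conj_transpose_def using assms by (intro continuous_intros)

lemma diag_matrix_mult: "diag_matrix a ** diag_matrix b = diag_matrix (\<lambda>i. a i * b i)"
proof -
  have "(\<Sum>k\<in>UNIV. (if i = k then a i else 0) * (if k = j then b k else 0)) = (if i = j then a i * b i else 0)" for i j
  proof -
    have "(\<Sum>k\<in>UNIV. (if i = k then a i else 0) * (if k = j then b k else 0))
        = (\<Sum>k\<in>UNIV. if i = k then a i * (if k = j then b k else 0) else 0)"
      by (intro sum.cong) auto
    then show ?thesis by simp
  qed
  then show ?thesis
    by (simp add: diag_matrix_def matrix_matrix_mult_def vec_eq_iff)
qed

lemma conj_transpose_diag_matrix: "conj_transpose (diag_matrix d) = diag_matrix (\<lambda>i. cnj (d i))"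
  by (simp add: conj_transpose_def diag_matrix_def vec_eq_iff)

lemma diag_matrix_eq_mat_1_iff: "diag_matrix d = mat 1 \<longleftrightarrow> (\<forall>i. d i = 1)"
  by (auto simp: diag_matrix_def mat_def vec_eq_iff)

lemma unitary_diag_matrix_iff: "unitary_matrix (diag_matrix d) \<longleftrightarrow> (\<forall>i. norm (d i) = 1)"
proof -
  have "z * cnj z = 1 \<longleftrightarrow> norm z = 1" for z
    by (simp flip: complex_norm_square of_real_power add: power2_eq_1_iff)
       (metis norm_ge_zero abs_1 abs_of_nonneg abs_minus_cancel)
  then show ?thesis
    by (auto simp: unitary_matrix_def conj_transpose_diag_matrix diag_matrix_mult
        diag_matrix_eq_mat_1_iff mult.commute)
qed

lemma unitary_matrix_conj_transpose: "unitary_matrix P \<Longrightarrow> unitary_matrix (conj_transpose P)"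
  by (simp add: unitary_matrix_def conj_transpose_conj_transpose)

definition conj_by :: "complex^'n^'n \<Rightarrow> complex^'n^'n \<Rightarrow> complex^'n^'n" where
  "conj_by P A = conj_transpose P ** A ** P"

lemma conj_by_mult:
  assumes "unitary_matrix P"
  shows "conj_by P (A ** B) = conj_by P A ** conj_by P B"
proof -
  have "conj_by P A ** conj_by P B = conj_transpose P ** A ** (P ** conj_transpose P) ** B ** P"
    by (simp only: conj_by_def matrix_mul_assoc)
  also have "\<dots> = conj_transpose P ** A ** B ** P"
    using assms by (simp add: unitary_matrix_def)
  finally show ?thesis
    by (simp add: conj_by_def matrix_mul_assoc)
qed

lemma conj_by_conj_transpose:
  assumes "unitary_matrix P"
  shows "conj_by (conj_transpose P) (conj_by P A) = A" "conj_by P (conj_by (conj_transpose P) A) = A"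
proof -
  have "conj_by (conj_transpose P) (conj_by P A) = (P ** conj_transpose P) ** A ** (P ** conj_transpose P)"
    by (simp only: conj_by_def conj_transpose_conj_transpose matrix_mul_assoc)
  then show "conj_by (conj_transpose P) (conj_by P A) = A"
    using assms by (simp add: unitary_matrix_def)
  have "conj_by P (conj_by (conj_transpose P) A) = (conj_transpose P ** P) ** A ** (conj_transpose P ** P)"
    by (simp only: conj_by_def conj_transpose_conj_transpose matrix_mul_assoc)
  then show "conj_by P (conj_by (conj_transpose P) A) = A"
    using assms by (simp add: unitary_matrix_def)
qed

lemma unitary_conj_by: "unitary_matrix P \<Longrightarrow> unitary_matrix A \<Longrightarrow> unitary_matrix (conj_by P A)"
  by (simp add: conj_by_def unitary_matrix_mult unitary_matrix_conj_transpose)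

lemma conj_by_in_SU:
  assumes "unitary_matrix P" "A \<in> carrier SU"
  shows "conj_by P A \<in> carrier SU"
proof -
  have "det (conj_by P A) = det (conj_transpose P ** P) * det A"
    by (simp add: conj_by_def det_mul)
  then show ?thesis
    using assms by (simp add: SU_def unitary_conj_by unitary_matrix_def[of P])
qed

lemma continuous_on_conj_by:
  assumes "continuous_on S P" "continuous_on S A"
  shows "continuous_on S (\<lambda>x. conj_by (P x) (A x))"
  unfolding conj_by_def using assms by (intro continuous_on_matrix_mult continuous_on_conj_transpose)

lemma homeomorphism_conj_by:
  assumes "unitary_matrix P"
  shows "homeomorphism (carrier SU) (carrier SU) (conj_by P) (conj_by (conj_transpose P))"
  using assms
  by (auto intro!: homeomorphismI continuous_on_conj_by continuous_intros
      simp: conj_by_in_SU conj_by_conj_transpose unitary_matrix_conj_transpose)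

lemma conj_by_iso_SU:
  assumes "unitary_matrix P"
  shows "conj_by P \<in> iso SU SU"
proof (rule isoI)
  show "conj_by P \<in> hom SU SU"
    using assms by (auto simp: hom_def conj_by_in_SU) (simp add: SU_def conj_by_mult)
  show "bij_betw (conj_by P) (carrier SU) (carrier SU)"
    using assms by (intro bij_betw_byWitness[where f' = "conj_by (conj_transpose P)"])
      (auto simp: conj_by_in_SU conj_by_conj_transpose unitary_matrix_conj_transpose)
qed

section \<open>Ambient automorphisms from paths of unitary matrices\<close>

text \<open>
  In an orthonormal eigenbasis \<open>P\<close> is the diagonal matrix with entries \<open>cis (\<theta> i)\<close>; replacing each
  angle \<open>\<theta> i\<close> by \<open>t * \<theta> i\<close> moves from the identity to \<open>P\<close>.
\<close>

lemma unitary_path_from_identity: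
  fixes P :: "complex^'n^'n"
  assumes P: "unitary_matrix P"
  obtains p :: "real \<Rightarrow> complex^'n^'n"
  where "continuous_on UNIV p" "\<And>t. unitary_matrix (p t)" "p 0 = mat 1" "p 1 = P"
proof -
  obtain Q d where Q: "unitary_matrix Q" and d: "conj_by Q P = diag_matrix d"
    using commuting_unitary_simultaneously_diagonalizable[of "{P}"] P by (auto simp: conj_by_def)
  have "norm (d i) = 1" for i
    using unitary_conj_by[OF Q P] by (simp add: d unitary_diag_matrix_iff)
  then have "\<forall>i. \<exists>\<theta>. d i = cis \<theta>"
    by (metis cis_Arg norm_eq_zero zero_neq_one sgn_eq div_by_1 of_real_1)
  then obtain \<theta> where \<theta>: "\<And>i. d i = cis (\<theta> i)"
    by metis
  define p where "p = (\<lambda>t. conj_by (conj_transpose Q) (diag_matrix (\<lambda>i. cis (t * \<theta> i))))"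
  have "continuous_on UNIV (\<lambda>t. if i = j then cis (t * \<theta> i) else 0)" for i j
    by (cases "i = j") (auto intro!: continuous_intros)
  then have "continuous_on UNIV p"
    unfolding p_def diag_matrix_def
    by (intro continuous_on_conj_by continuous_on_vec_lambda continuous_on_const)
  moreover have "unitary_matrix (p t)" for t
    using Q by (simp add: p_def unitary_conj_by unitary_matrix_conj_transpose unitary_diag_matrix_iff)
  moreover have "p 0 = mat 1"
  proof -
    have "diag_matrix (\<lambda>i. cis (0 * \<theta> i)) = mat 1"
      by (simp add: diag_matrix_eq_mat_1_iff)
    then show ?thesis
      using Q by (simp add: p_def conj_by_def unitary_matrix_def conj_transpose_conj_transpose)
  qed
  moreover have "p 1 = P"
    using conj_by_conj_transpose(1)[OF Q, of P] by (simp add: p_def d flip: \<theta>)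
  ultimately show ?thesis
    using that by blast
qed

text \<open>
  The automorphism at time \<open>t\<close> is conjugation by the point at \<open>t\<close> of a path of unitary matrices from
  the identity to \<open>P\<close>. The determinant may vary along the path, since conjugation by any unitary matrix
  preserves \<open>SU\<close>.
\<close>

lemma ambient_automorphic_conj_by:
  assumes P: "unitary_matrix P"
  shows "ambient_automorphic SU \<phi> (\<lambda>z. conj_by P (\<phi> z))"
proof -
  obtain p where cont: "continuous_on UNIV p" and unit: "\<And>t::real. unitary_matrix (p t)"
    and p0: "p 0 = mat 1" and p1: "p 1 = P"
    using unitary_path_from_identity[OF P] by blast
  let ?F = "\<lambda>(A, t). conj_by (p t) A"
  have "continuous_on (carrier SU \<times> {0..1}) ?F"
    unfolding case_prod_beta
    by (intro continuous_on_conj_by continuous_on_compose2[OF cont] continuous_intros) auto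
  moreover have "?F ` (carrier SU \<times> {0..1}) \<subseteq> carrier SU"
    using unit by (auto intro: conj_by_in_SU)
  moreover have "?F (A, 0) = A" for A
    by (simp add: p0 conj_by_def conj_transpose_mat_1)
  moreover have "\<exists>g. homeomorphism (carrier SU) (carrier SU) (\<lambda>A. ?F (A, t)) g" for t
    using homeomorphism_conj_by[OF unit[of t]] by auto
  moreover have "(\<lambda>A. ?F (A, t)) \<in> iso SU SU" for t
    using conj_by_iso_SU[OF unit[of t]] by simp
  ultimately have "ambient_automorphism SU \<phi> (\<lambda>z. conj_by P (\<phi> z)) ?F"
    by (simp add: ambient_automorphism_def p1)
  then show ?thesis
    unfolding ambient_automorphic_def by blast
qed

text \<open>
  Continuity of the inverse comes for free: a continuous injection of the compact circle is an
  embedding.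
\<close>

lemma knotted_subgroup_conj_by:
  assumes \<phi>: "knotted_subgroup SU \<phi>" and P: "unitary_matrix P"
  shows "knotted_subgroup SU (\<lambda>z. conj_by P (\<phi> z))"
proof -
  let ?C = "carrier circle_group" and ?\<gamma> = "\<lambda>z. conj_by P (\<phi> z)"
  have hom: "\<phi> \<in> hom circle_group SU" and cont: "continuous_on ?C \<phi>" and inj: "inj_on \<phi> ?C"
    using \<phi> by (simp_all add: knotted_subgroup_def)
  have "conj_by P \<circ> \<phi> \<in> hom circle_group SU"
    using conj_by_iso_SU[OF P] hom by (intro hom_compose[of \<phi> circle_group SU]) (auto simp: iso_def)
  then have "?\<gamma> \<in> hom circle_group SU"
    by (simp add: o_def)
  moreover have cont': "continuous_on ?C ?\<gamma>"
    by (intro continuous_on_conj_by continuous_intros cont)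
  moreover have inj': "inj_on ?\<gamma> ?C"
    using inj conj_by_conj_transpose(1)[OF P] by (metis (mono_tags, lifting) inj_on_def)
  moreover have "continuous_on (?\<gamma> ` ?C) (inv_into ?C ?\<gamma>)"
  proof (rule continuous_on_inv[OF cont'])
    show "compact ?C"
      by (simp add: circle_group_def)
    show "\<forall>z\<in>?C. inv_into ?C ?\<gamma> (?\<gamma> z) = z"
      using inv_into_f_f[OF inj'] by blast
  qed
  ultimately show ?thesis
    by (simp add: knotted_subgroup_def)
qed

section \<open>Diagonal form of a knotted subgroup\<close>

theorem theorem5:
  fixes \<phi> :: "complex \<Rightarrow> complex^'n^'n"
  assumes "CARD('n) \<ge> 2"
    and "knotted_subgroup SU \<phi>"
  shows "\<exists>(\<gamma> :: complex \<Rightarrow> complex^'n^'n) (\<beta> :: 'n \<Rightarrow> real).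
           knotted_subgroup SU \<gamma> \<and>
           (\<forall>t::real. \<gamma> (cis t) = diag_matrix (\<lambda>l. exp (\<i> * complex_of_real t * complex_of_real (\<beta> l)))) \<and>
           ambient_automorphic SU \<phi> \<gamma>"
proof -
  let ?C = "carrier circle_group"
  have cont: "continuous_on ?C \<phi>" and hom: "\<phi> \<in> hom circle_group SU"
    using assms(2) by (simp_all add: knotted_subgroup_def)
  have unit: "unitary_matrix (\<phi> z)" if "z \<in> ?C" for z
    using hom_in_carrier[OF hom that] by (simp add: SU_def)
  have mult: "\<phi> (w * z) = \<phi> w ** \<phi> z" if "w \<in> ?C" "z \<in> ?C" for w z
    using hom_mult[OF hom that] by (simp add: SU_def circle_group_def)
  have cis: "cis t \<in> ?C" for t
    by (simp add: circle_group_def)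
  have "A ** B = B ** A" if "A \<in> \<phi> ` ?C" "B \<in> \<phi> ` ?C" for A B
    using that mult by (metis imageE mult.commute)
  then obtain P where P: "unitary_matrix P"
    and diag: "\<forall>A\<in>\<phi> ` ?C. \<exists>d. conj_by P A = diag_matrix d"
    using commuting_unitary_simultaneously_diagonalizable[of "\<phi> ` ?C"] unit
    unfolding conj_by_def by blast
  define \<gamma> where "\<gamma> = (\<lambda>z. conj_by P (\<phi> z))"
  have "\<forall>t. \<exists>d. \<gamma> (cis t) = diag_matrix d"
    using diag cis by (auto simp: \<gamma>_def)
  then obtain d where d: "\<And>t. \<gamma> (cis t) = diag_matrix (d t)"
    by metis
  have entry: "d t l = \<gamma> (cis t) $ l $ l" for t l
    by (simp add: d diag_matrix_def)
  have "\<exists>\<beta>::real. \<forall>t. d t l = exp (\<i> * of_real t * of_real \<beta>)" for l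
  proof (rule continuous_unitary_character_of_reals)
    have "continuous_on ?C \<gamma>"
      unfolding \<gamma>_def by (intro continuous_on_conj_by continuous_intros cont)
    then have "continuous_on UNIV (\<lambda>t. \<gamma> (cis t))"
      by (rule continuous_on_compose2) (use cis in \<open>auto intro: continuous_intros\<close>)
    then show "continuous_on UNIV (\<lambda>t. d t l)"
      unfolding entry by (intro continuous_intros)
    show "d (s + t) l = d s l * d t l" for s t
    proof -
      have "\<gamma> (cis (s + t)) = diag_matrix (d s) ** diag_matrix (d t)"
        by (simp add: \<gamma>_def mult cis conj_by_mult[OF P] flip: cis_mult d)
      then show ?thesis
        unfolding entry[of "s + t"] diag_matrix_mult by (simp add: diag_matrix_def)
    qed
    show "norm (d t l) = 1" for t
      using unitary_conj_by[OF P unit[OF cis[of t]]] d[of t]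
      by (simp add: \<gamma>_def unitary_diag_matrix_iff)
  qed
  then obtain \<beta> :: "'n \<Rightarrow> real" where \<beta>: "\<And>l t. d t l = exp (\<i> * of_real t * of_real (\<beta> l))"
    by metis
  have "\<gamma> (cis t) = diag_matrix (\<lambda>l. exp (\<i> * of_real t * of_real (\<beta> l)))" for t
    by (simp add: d \<beta>[symmetric])
  then show ?thesis
    using knotted_subgroup_conj_by[OF assms(2) P] ambient_automorphic_conj_by[OF P]
    unfolding \<gamma>_def by blast
qed

end
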